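(* Let $j\in\{2,3,4\}$, $\lambda\in\{1,-1\}$, let $r>0$ be constant, and let $\beta$ be a unit-speed spacelike curve in $\mathbb{E}^4_1$ with non-null Frenet frame $\{F_1,F_2,F_3,F_4\}$ whose timelike member is $F_j$. Let $M$ be the tubular hypersurface $$\mathcal{T}^{\{j,\lambda\}}(s,t,w)=\beta(s)+r\sum_{i=2}^4\mu_i^{\lambda}F_i(s)$$ with Gauss map $N^{\{j,\lambda\}}=-(-1)^{(4-j)!}\lambda^j\sum_{i=2}^4\mu_i^\lambda F_i$. Then $M$ does not have generalized $\mathcal{L}_1$ 1-type Gauss map; that is, there do not exist non-zero smooth functions $\mathfrak{m},\mathfrak{n}$ on $M$ and a non-zero constant vector $C\in\mathbb{E}^4_1$ such that $\mathcal{L}_1N^{\{j,\lambda\}}=\mathfrak{m}N^{\{j,\lambda\}}+\mathfrak{n}C$.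
   Context: $\mathbb{E}^4_1$ is $\mathbb{R}^4$ with the metric $\langle\ ,\ \rangle=-dx_1^2+dx_2^2+dx_3^2+dx_4^2$. The curve $\beta:I\to\mathbb{E}^4_1$ ($I$ an open interval) is smooth with $\beta'=F_1$, and $\{F_1,\dots,F_4\}$ is a smooth orthonormal frame along $\beta$ with $\langle F_j,F_j\rangle=-1$ and $\langle F_i,F_i\rangle=1$ for $i\neq j$, satisfying, with smooth curvature functions $k_1,k_2,k_3$ of $s$, the Frenet equations - $j=2$: $F_1'=k_1F_2$, $F_2'=k_1F_1+k_2F_3$, $F_3'=k_2F_2+k_3F_4$, $F_4'=-k_3F_3$; - $j=3$: $F_1'=k_1F_2$, $F_2'=-k_1F_1+k_2F_3$, $F_3'=k_2F_2+k_3F_4$, $F_4'=k_3F_3$; - $j=4$: $F_1'=k_1F_2$, $F_2'=-k_1F_1+k_2F_3$, $F_3'=-k_2F_2+k_3F_4$, $F_4'=k_3F_3$. The functions $\mu_i^\lambda$ (depending on $j$) are given by $\mu_j^\lambda=(\sinh w)^{\frac{1+\lambda}2}(\cosh w)^{\frac{1-\lambda}2}\cosh t$, $\mu_{j+1}^\lambda=(\sinh w)^{\frac{1-\lambda}2}(\cosh w)^{\frac{1+\lambda}2}$, $\mu_{j+2}^\lambda=(\sinh w)^{\frac{1+\lambda}2}(\cosh w)^{\frac{1-\lambda}2}\sinh t$, with the index convention $\mu_5^\lambda=\mu_2^\lambda$, $\mu_6^\lambda=\mu_3^\lambda$. ($\lambda=1$: envelope of pseudo hyperspheres; $\lambda=-1$: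 envelope of pseudo hyperbolic hyperspheres, of radius $r$ centered on $\beta$.) The parameters $(s,t,w)$ range over a connected open set $U\subset I\times\mathbb{R}^2$ projecting onto $I$ on which $\mathcal{T}^{\{j,\lambda\}}$ is an immersion, i.e. $(\mu_{j+1}^\lambda)_w\neq0$ and $1+(-1)^{(4-j)!}rk_1\mu_2^\lambda\neq0$. The unit normal $N=N^{\{j,\lambda\}}$ has $\varepsilon=\langle N,N\rangle=\lambda$, and the principal curvatures with respect to $N$ (eigenvalues of $-dN$) are $\kappa_1=\kappa_2=\frac{(-1)^{(4-j)!}\lambda^j}{r}$, $\kappa_3=\frac{k_1\mu_2^\lambda}{\lambda^j(1+(-1)^{(4-j)!}rk_1\mu_2^\lambda)}$. Operator $\mathcal{L}_1$ (Cheng–Yau) on the Gauss map: put $a_1=-\sum_i\kappa_i$, $a_k=(-1)^k\sum_{i_1<\dots<i_k}\kappa_{i_1}\cdots\kappa_{i_k}$ ($k=2,3$), and define $H_k$ by $\binom{3}{k}H_k=(-\varepsilon)^ka_k$. Then $$\mathcal{L}_1N=-\varepsilon\,\mathfrak{C}_1\big(\nabla H_2+(3H_1H_2-H_3)N\big),\qquad \mathfrak{C}_1=\binom32(-\varepsilon)=-3\varepsilon,$$ where $\nabla$ is the gradient on $M$ with respect to the induced metric, viewed as an $\mathbb{E}^4_1$-valued map. "Non-zero function" means not identically zero. *)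

theory Defs
  imports "HOL-Analysis.Analysis"
begin

definition mink :: "real ^ 4 \<Rightarrow> real ^ 4 \<Rightarrow> real" where
  "mink x y = - (x $ 1 * y $ 1) + x $ 2 * y $ 2 + x $ 3 * y $ 3 + x $ 4 * y $ 4"

(* C^k on an open subset of a finite-dimensional space: directional derivatives in all
   directions v are required to be C^(k-1). *)
primrec Ck_on :: "nat \<Rightarrow> 'a set \<Rightarrow> ('a::euclidean_space \<Rightarrow> 'b::real_normed_vector) \<Rightarrow> bool" where
  "Ck_on 0 U f \<longleftrightarrow> continuous_on U f"
| "Ck_on (Suc k) U f \<longleftrightarrow>
     (\<forall>p\<in>U. f differentiable (at p)) \<and> (\<forall>v. Ck_on k U (\<lambda>p. frechet_derivative f (at p) v))"

definition smooth_on :: "'a set \<Rightarrow> ('a::euclidean_space \<Rightarrow> 'b::real_normed_vector) \<Rightarrow> bool" where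
  "smooth_on U f \<longleftrightarrow> (\<forall>k. Ck_on k U f)"

(* Vectors F 1, ..., F 4 and curvatures k 1, k 2, k 3; other indices are irrelevant.
   Unit speed and spacelikeness of \<beta> follow from \<beta>' = F 1 and mink (F 1) (F 1) = 1,
   since j is 2, 3 or 4. *)
definition frenet_curve ::
  "real set \<Rightarrow> nat \<Rightarrow> (real \<Rightarrow> real ^ 4) \<Rightarrow> (nat \<Rightarrow> real \<Rightarrow> real ^ 4) \<Rightarrow> (nat \<Rightarrow> real \<Rightarrow> real) \<Rightarrow> bool" where
  "frenet_curve I j \<beta> F k \<longleftrightarrow>
     smooth_on I \<beta> \<and> (\<forall>i\<in>{1..4}. smooth_on I (F i)) \<and> (\<forall>i\<in>{1..3}. smooth_on I (k i)) \<and>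
     (\<forall>s\<in>I. \<forall>i\<in>{1..4}. \<forall>l\<in>{1..4}.
        mink (F i s) (F l s) = (if i \<noteq> l then 0 else if i = j then -1 else 1)) \<and>
     (\<forall>s\<in>I. (\<beta> has_vector_derivative F 1 s) (at s)) \<and>
     (j = 2 \<longrightarrow> (\<forall>s\<in>I.
        (F 1 has_vector_derivative k 1 s *\<^sub>R F 2 s) (at s) \<and>
        (F 2 has_vector_derivative k 1 s *\<^sub>R F 1 s + k 2 s *\<^sub>R F 3 s) (at s) \<and>
        (F 3 has_vector_derivative k 2 s *\<^sub>R F 2 s + k 3 s *\<^sub>R F 4 s) (at s) \<and>
        (F 4 has_vector_derivative - k 3 s *\<^sub>R F 3 s) (at s))) \<and>
     (j = 3 \<longrightarrow> (\<forall>s\<in>I.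
        (F 1 has_vector_derivative k 1 s *\<^sub>R F 2 s) (at s) \<and>
        (F 2 has_vector_derivative - k 1 s *\<^sub>R F 1 s + k 2 s *\<^sub>R F 3 s) (at s) \<and>
        (F 3 has_vector_derivative k 2 s *\<^sub>R F 2 s + k 3 s *\<^sub>R F 4 s) (at s) \<and>
        (F 4 has_vector_derivative k 3 s *\<^sub>R F 3 s) (at s))) \<and>
     (j = 4 \<longrightarrow> (\<forall>s\<in>I.
        (F 1 has_vector_derivative k 1 s *\<^sub>R F 2 s) (at s) \<and>
        (F 2 has_vector_derivative - k 1 s *\<^sub>R F 1 s + k 2 s *\<^sub>R F 3 s) (at s) \<and>
        (F 3 has_vector_derivative - k 2 s *\<^sub>R F 2 s + k 3 s *\<^sub>R F 4 s) (at s) \<and>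
        (F 4 has_vector_derivative k 3 s *\<^sub>R F 3 s) (at s)))"

definition wrap :: "nat \<Rightarrow> nat" where
  "wrap m = (if m > 4 then m - 3 else m)"

(* lam is 1 or -1, so the exponents (1 \<plusminus> lam) / 2 are the integers 0 and 1; integer powers keep
   the value correct also where sinh w \<le> 0. *)
definition mu :: "nat \<Rightarrow> int \<Rightarrow> nat \<Rightarrow> real \<Rightarrow> real \<Rightarrow> real" where
  "mu j lam i t w =
     (if i = wrap j then
        sinh w powi ((1 + lam) div 2) * cosh w powi ((1 - lam) div 2) * cosh t
      else if i = wrap (j + 1) then
        sinh w powi ((1 - lam) div 2) * cosh w powi ((1 + lam) div 2)
      else if i = wrap (j + 2) then
        sinh w powi ((1 + lam) div 2) * cosh w powi ((1 - lam) div 2) * sinh t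
      else 0)"

(* Parameter points p have coordinates (s, t, w) = (p $ 1, p $ 2, p $ 3). *)
definition tube ::
  "nat \<Rightarrow> int \<Rightarrow> real \<Rightarrow> (real \<Rightarrow> real ^ 4) \<Rightarrow> (nat \<Rightarrow> real \<Rightarrow> real ^ 4) \<Rightarrow> real ^ 3 \<Rightarrow> real ^ 4" where
  "tube j lam r \<beta> F p =
     \<beta> (p $ 1) + r *\<^sub>R (\<Sum>i = 2..4. mu j lam i (p $ 2) (p $ 3) *\<^sub>R F i (p $ 1))"

definition tube_normal ::
  "nat \<Rightarrow> int \<Rightarrow> (nat \<Rightarrow> real \<Rightarrow> real ^ 4) \<Rightarrow> real ^ 3 \<Rightarrow> real ^ 4" where
  "tube_normal j lam F p =
     - ((-1) ^ fact (4 - j) * of_int lam ^ j) *\<^sub>R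
       (\<Sum>i = 2..4. mu j lam i (p $ 2) (p $ 3) *\<^sub>R F i (p $ 1))"

text \<open>
  Below, \<open>X\<close> is a parametrized hypersurface with unit normal \<open>N\<close>. Functions on the hypersurface
  are given through the parametrization, and tangent vectors at \<open>p\<close> are the values of the
  differential of \<open>X\<close> at \<open>p\<close>.
\<close>

definition immersion_on :: "(real ^ 3) set \<Rightarrow> (real ^ 3 \<Rightarrow> real ^ 4) \<Rightarrow> bool" where
  "immersion_on U X \<longleftrightarrow>
     (\<forall>p\<in>U. X differentiable (at p) \<and> inj (frechet_derivative X (at p)))"

definition grad ::
  "(real ^ 3 \<Rightarrow> real ^ 4) \<Rightarrow> (real ^ 3 \<Rightarrow> real) \<Rightarrow> real ^ 3 \<Rightarrow> real ^ 4" where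
  "grad X f p = (THE v. v \<in> range (frechet_derivative X (at p)) \<and>
     (\<forall>u. mink v (frechet_derivative X (at p) u) = frechet_derivative f (at p) u))"

(* \<kappa> 1, \<kappa> 2, \<kappa> 3 are the eigenvalues of the endomorphism -dN of the tangent space, repeated
   according to multiplicity: the v i are the coordinate vectors of an eigenbasis. *)
definition are_principal_curvatures ::
  "(real ^ 3 \<Rightarrow> real ^ 4) \<Rightarrow> (real ^ 3 \<Rightarrow> real ^ 4) \<Rightarrow> real ^ 3 \<Rightarrow> (nat \<Rightarrow> real) \<Rightarrow> bool" where
  "are_principal_curvatures X N p \<kappa> \<longleftrightarrow>
     (\<exists>v :: nat \<Rightarrow> real ^ 3. inj_on v {1..3} \<and> independent (v ` {1..3}) \<and>
        (\<forall>i\<in>{1..3}. - frechet_derivative N (at p) (v i) =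
                      \<kappa> i *\<^sub>R frechet_derivative X (at p) (v i)))"

(* The list of principal curvatures is determined only up to order. The choice made here does
   not matter, because only symmetric functions of it are used. *)
definition principal_curvature ::
  "(real ^ 3 \<Rightarrow> real ^ 4) \<Rightarrow> (real ^ 3 \<Rightarrow> real ^ 4) \<Rightarrow> real ^ 3 \<Rightarrow> nat \<Rightarrow> real" where
  "principal_curvature X N p = (SOME \<kappa>. are_principal_curvatures X N p \<kappa>)"

definition curv_coeff ::
  "(real ^ 3 \<Rightarrow> real ^ 4) \<Rightarrow> (real ^ 3 \<Rightarrow> real ^ 4) \<Rightarrow> nat \<Rightarrow> real ^ 3 \<Rightarrow> real" where
  "curv_coeff X N k p =
     (-1) ^ k * (\<Sum>A | A \<subseteq> {1..3} \<and> card A = k. \<Prod>i\<in>A. principal_curvature X N p i)"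

definition mean_curv ::
  "(real ^ 3 \<Rightarrow> real ^ 4) \<Rightarrow> (real ^ 3 \<Rightarrow> real ^ 4) \<Rightarrow> nat \<Rightarrow> real ^ 3 \<Rightarrow> real" where
  "mean_curv X N k p =
     (- mink (N p) (N p)) ^ k * curv_coeff X N k p / of_nat (3 choose k)"

(* The Cheng-Yau operator L1 applied componentwise to the Gauss map. With \<epsilon> = mink N N, shape
   operator S = -dN and L1 f = trace (P1 o Hess f), where P1 = a1 I + S for a1 = - trace S, the
   Codazzi equation gives
     L1 N = -\<epsilon> C1 (grad H2 + (3 H1 H2 - H3) N),  C1 = (3 choose 2) (-\<epsilon>),
   which is used as the definition. *)
definition L1_gauss ::
  "(real ^ 3 \<Rightarrow> real ^ 4) \<Rightarrow> (real ^ 3 \<Rightarrow> real ^ 4) \<Rightarrow> real ^ 3 \<Rightarrow> real ^ 4" where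
  "L1_gauss X N p =
     (let \<epsilon> = mink (N p) (N p); C1 = of_nat (3 choose 2) * (- \<epsilon>);
          H = (\<lambda>k. mean_curv X N k p)
      in (- \<epsilon> * C1) *\<^sub>R
           (grad X (mean_curv X N 2) p + (3 * H 1 * H 2 - H 3) *\<^sub>R N p))"

definition generalized_L1_1type_gauss ::
  "(real ^ 3) set \<Rightarrow> (real ^ 3 \<Rightarrow> real ^ 4) \<Rightarrow> (real ^ 3 \<Rightarrow> real ^ 4) \<Rightarrow> bool" where
  "generalized_L1_1type_gauss U X N \<longleftrightarrow>
     (\<exists>(m :: real ^ 3 \<Rightarrow> real) (n :: real ^ 3 \<Rightarrow> real) (C :: real ^ 4).
        smooth_on U m \<and> smooth_on U n \<and> (\<exists>p\<in>U. m p \<noteq> 0) \<and> (\<exists>p\<in>U. n p \<noteq> 0) \<and> C \<noteq> 0 \<and>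
        (\<forall>p\<in>U. L1_gauss X N p = m p *\<^sub>R N p + n p *\<^sub>R C))"

end

theory Submission
  imports Defs
begin

text \<open>
  With \<open>G = \<Sum>\<mu>\<^sub>i F\<^sub>i\<close>, \<open>\<eta> = (-1)^(4-j)!\<close> and \<open>f = 1 + r \<eta> k\<^sub>1 \<mu>\<^sub>2\<close>, the second elementary symmetric function of
  the principal curvatures is \<open>(3 - 2 / f) / r\<^sup>2\<close>. Pairing \<open>L1 N = m N + n C\<close> with tangent vectors
  \<open>dX u\<close> therefore gives \<open>K \<langle>C, dX u\<rangle> = 2 df u\<close> for \<open>K = n f\<^sup>2 r\<^sup>2\<close>, in which neither \<open>m\<close> nor \<open>H\<^sub>1\<close>, \<open>H\<^sub>3\<close> occur.
  Put \<open>c\<^sub>i = \<langle>C, F\<^sub>i\<rangle>\<close>. Where \<open>n \<noteq> 0\<close>, the directions \<open>t\<close> and \<open>w\<close> force \<open>c\<^sub>3 = c\<^sub>4 = 0\<close> and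
  \<open>K c\<^sub>2 = 2 \<eta> k\<^sub>1\<close>, and the direction \<open>s\<close> then becomes \<open>K c\<^sub>1 f = 2 r \<eta> k\<^sub>1' \<mu>\<^sub>2\<close>. Eliminating \<open>K\<close> leaves
  a relation affine in \<open>\<mu>\<^sub>2\<close>, so \<open>k\<^sub>1 c\<^sub>1 = 0 = c\<^sub>2 k\<^sub>1'\<close>. With \<open>c\<^sub>1' = k\<^sub>1 c\<^sub>2\<close> this yields \<open>c\<^sub>1 = c\<^sub>2 = 0\<close>,
  that is \<open>C = 0\<close>.
\<close>

section \<open>The Minkowski form\<close>

lemma bounded_bilinear_mink: "bounded_bilinear mink"
proof -
  have "bounded_linear (\<lambda>y::real^4. mink x y)" for x
    unfolding mink_def
    by (intro bounded_linear_add bounded_linear_minus bounded_linear_const_mult bounded_linear_vec_nth)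
  moreover have "bilinear mink"
    unfolding bilinear_def
    by (auto intro!: linearI simp: mink_def algebra_simps)
  ultimately show ?thesis
    by (simp add: bilinear_conv_bounded_bilinear)
qed

interpretation mink: bounded_bilinear mink
  by (rule bounded_bilinear_mink)

lemma mink_commute: "mink x y = mink y x"
  by (simp add: mink_def algebra_simps)

lemma mink_nondegenerate:
  assumes "\<And>y. mink x y = 0"
  shows "x = 0"
proof -
  have "x $ i = 0" for i :: 4
    using assms[of "axis i 1"] exhaust_4[of i] by (auto simp: mink_def axis_def)
  then show ?thesis by (simp add: vec_eq_iff)
qed

text \<open>Pairing a vanishing combination with \<open>F i\<close> isolates its i-th coefficient,
  so orthogonal non-null vectors are independent. Four of them span the space, and nondegeneracy of
  the form finishes the argument.\<close>

lemma mink_frame_nondegenerate: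
  fixes F :: "nat \<Rightarrow> real ^ 4"
  assumes orth: "\<And>i l. i \<in> {1..4} \<Longrightarrow> l \<in> {1..4} \<Longrightarrow> i \<noteq> l \<Longrightarrow> mink (F i) (F l) = 0"
    and nonnull: "\<And>i. i \<in> {1..4} \<Longrightarrow> mink (F i) (F i) \<noteq> 0"
    and x: "\<And>i. i \<in> {1..4} \<Longrightarrow> mink x (F i) = 0"
  shows "x = 0"
proof -
  define T where "T a = a $ 1 *\<^sub>R F 1 + a $ 2 *\<^sub>R F 2 + a $ 3 *\<^sub>R F 3 + a $ 4 *\<^sub>R F 4" for a :: "real ^ 4"
  have lin: "linear T"
    by (intro linearI) (auto simp: T_def algebra_simps)
  have "a = 0" if "T a = 0" for a
  proof -
    have "mink (T a) (F i) = 0" for i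
      using that by (simp add: mink.zero_left)
    from this[of 1] this[of 2] this[of 3] this[of 4] show ?thesis
      using orth nonnull
      by (simp add: T_def mink.add_left mink.scaleR_left vec_eq_iff forall_4)
  qed
  then have "inj T"
    using lin by (simp add: linear_injective_0)
  then have "surj T"
    using lin by (simp add: linear_injective_imp_surjective)
  have "mink x y = 0" for y
  proof -
    obtain a where "y = T a" using \<open>surj T\<close> by (meson surjD)
    then show ?thesis
      using x by (simp add: T_def mink.add_right mink.scaleR_right)
  qed
  then show ?thesis by (rule mink_nondegenerate)
qed

text \<open>A dimension count: by nondegeneracy the complement of \<open>G\<close> is a proper
  subspace, hence of dimension at most 3, and it contains the 3-dimensional range.\<close>

lemma range_eq_mink_complement:
  fixes L :: "real ^ 3 \<Rightarrow> real ^ 4"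
  assumes lin: "linear L" and inj: "inj L" and G: "G \<noteq> 0" and orth: "\<And>u. mink (L u) G = 0"
  shows "range L = {v. mink v G = 0}"
proof -
  let ?P = "{v. mink v G = 0}"
  have sub: "subspace ?P"
    by (auto simp: subspace_def mink.zero_left mink.add_left mink.scaleR_left)
  have "?P \<noteq> UNIV"
    using mink_nondegenerate[of G] G mink_commute by auto
  then have "dim ?P \<noteq> DIM(real ^ 4)"
    using sub dim_eq_full[of ?P] by (metis span_eq_iff)
  then have "dim ?P \<le> 3"
    using dim_subset_UNIV[of ?P] by simp
  moreover have "dim (range L) = 3"
    using dim_image_eq[OF lin, of UNIV] inj by simp
  moreover have "subspace (range L)"
    using lin by (simp add: linear_subspace_image)
  moreover have "range L \<subseteq> ?P"
    using orth by auto
  ultimately show ?thesis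
    using subspace_dim_equal[OF _ sub, of "range L"] by auto
qed

text \<open>The induced metric on the tangent space is nondegenerate because the normal is non-null:
  every \<open>y\<close> splits into a tangent vector and a multiple of \<open>G\<close>, and
  \<open>v\<close> is orthogonal to both.\<close>

lemma mink_orthogonal_range_eq_0:
  fixes L :: "real ^ 3 \<Rightarrow> real ^ 4"
  assumes lin: "linear L" and inj: "inj L" and G: "mink G G \<noteq> 0" and orth: "\<And>u. mink (L u) G = 0"
    and v: "v \<in> range L" "\<And>u. mink v (L u) = 0"
  shows "v = 0"
proof (rule mink_nondegenerate)
  fix y
  have "G \<noteq> 0" using G by (auto simp: mink.zero_left)
  then have R: "range L = {v. mink v G = 0}"
    using range_eq_mink_complement lin inj orth by blast
  let ?y = "y - (mink y G / mink G G) *\<^sub>R G"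
  have "?y \<in> range L"
    unfolding R using G by (simp add: mink.diff_left mink.scaleR_left)
  then have "mink v ?y = 0"
    using v(2) by auto
  moreover have "mink v G = 0"
    using v(1) R by auto
  ultimately show "mink v y = 0"
    by (simp add: mink.diff_right mink.scaleR_right)
qed

text \<open>Riesz representation for a possibly indefinite induced metric; it makes the
  \<open>THE\<close> in \<open>grad\<close> well defined. The Gram map \<open>B\<close> is injective
  by nondegeneracy, hence surjective.\<close>

lemma ex1_tangent_representative:
  fixes L :: "real ^ 3 \<Rightarrow> real ^ 4"
  assumes lin: "linear L" and inj: "inj L" and G: "mink G G \<noteq> 0" and orth: "\<And>u. mink (L u) G = 0"
    and h: "linear h"
  shows "\<exists>!v. v \<in> range L \<and> (\<forall>u. mink v (L u) = h u)"
proof (rule ex_ex1I)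
  define B where "B x = (\<chi> i. mink (L x) (L (axis i 1)))" for x
  have mB: "mink (L x) (L u) = (\<Sum>i\<in>UNIV. u $ i * B x $ i)" for x u
  proof -
    have "L u = L (\<Sum>i\<in>UNIV. u $ i *\<^sub>R axis i 1)"
      using basis_expansion[of u] by (simp add: scalar_mult_eq_scaleR)
    also have "\<dots> = (\<Sum>i\<in>UNIV. u $ i *\<^sub>R L (axis i 1))"
      using lin by (simp add: linear_sum linear_cmul)
    finally show ?thesis
      by (simp add: B_def mink.sum_right mink.scaleR_right)
  qed
  have linB: "linear B"
    using lin by (intro linearI)
      (auto simp: B_def vec_eq_iff linear_add linear_cmul mink.add_left mink.scaleR_left)
  have "x = 0" if "B x = 0" for x
  proof -
    have "L x = 0"
      by (rule mink_orthogonal_range_eq_0[OF lin inj G orth]) (auto simp: mB that)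
    then show ?thesis using lin inj by (simp add: linear_injective_0)
  qed
  then have "surj B"
    using linB by (simp add: linear_injective_0 linear_injective_imp_surjective)
  then obtain x where x: "B x = (\<chi> i. h (axis i 1))"
    by (metis surjD)
  have hsum: "h u = (\<Sum>i\<in>UNIV. u $ i * h (axis i 1))" for u
  proof -
    have "h u = h (\<Sum>i\<in>UNIV. u $ i *\<^sub>R axis i 1)"
      using basis_expansion[of u] by (simp add: scalar_mult_eq_scaleR)
    then show ?thesis using h by (simp add: linear_sum linear_cmul)
  qed
  have "mink (L x) (L u) = h u" for u
    unfolding mB x hsum[of u] by simp
  then show "\<exists>v. v \<in> range L \<and> (\<forall>u. mink v (L u) = h u)" by blast
next
  fix v w
  assume v: "v \<in> range L \<and> (\<forall>u. mink v (L u) = h u)" and w: "w \<in> range L \<and> (\<forall>u. mink w (L u) = h u)"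
  have "v - w \<in> range L"
    using v w linear_diff[OF lin] by (metis (no_types, lifting) imageE rangeI)
  then have "v - w = 0"
    by (rule mink_orthogonal_range_eq_0[OF lin inj G orth]) (use v w in \<open>auto simp: mink.diff_left\<close>)
  then show "v = w" by simp
qed

lemma mink_grad:
  assumes "X differentiable (at p)" "inj (frechet_derivative X (at p))" "mink G G \<noteq> 0"
    and "\<And>u. mink (frechet_derivative X (at p) u) G = 0" and "f differentiable (at p)"
  shows "mink (grad X f p) (frechet_derivative X (at p) u) = frechet_derivative f (at p) u"
proof -
  have "grad X f p \<in> range (frechet_derivative X (at p)) \<and>
     (\<forall>u. mink (grad X f p) (frechet_derivative X (at p) u) = frechet_derivative f (at p) u)"
    unfolding grad_def
    by (rule theI', rule ex1_tangent_representative[where G = G])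
      (use assms linear_frechet_derivative in auto)
  then show "mink (grad X f p) (frechet_derivative X (at p) u) = frechet_derivative f (at p) u" by auto
qed

section \<open>The hyperbolic coefficients\<close>

text \<open>For \<open>lam\<close> in {1, -1}, \<open>phi\<close> and \<open>psi\<close> are the two
  products of powers in \<open>mu\<close>, evaluated. Each is the derivative of the other, so both
  values of \<open>lam\<close> can be treated together.\<close>

definition phi :: "int \<Rightarrow> real \<Rightarrow> real" where
  "phi lam w = (if lam = 1 then sinh w else cosh w)"

definition psi :: "int \<Rightarrow> real \<Rightarrow> real" where
  "psi lam w = (if lam = 1 then cosh w else sinh w)"

definition mu_t :: "nat \<Rightarrow> int \<Rightarrow> nat \<Rightarrow> real \<Rightarrow> real \<Rightarrow> real" where
  "mu_t j lam i t w =
     (if i = wrap j then phi lam w * sinh t else if i = wrap (j + 1) then 0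
      else if i = wrap (j + 2) then phi lam w * cosh t else 0)"

definition mu_w :: "nat \<Rightarrow> int \<Rightarrow> nat \<Rightarrow> real \<Rightarrow> real \<Rightarrow> real" where
  "mu_w j lam i t w =
     (if i = wrap j then psi lam w * cosh t else if i = wrap (j + 1) then phi lam w
      else if i = wrap (j + 2) then psi lam w * sinh t else 0)"

lemma mu_eq:
  assumes "lam \<in> {1, -1}"
  shows "mu j lam i t w =
     (if i = wrap j then phi lam w * cosh t else if i = wrap (j + 1) then psi lam w
      else if i = wrap (j + 2) then phi lam w * sinh t else 0)"
  using assms by (auto simp: mu_def phi_def psi_def)

lemma phi_derivative: "lam \<in> {1, -1} \<Longrightarrow> (phi lam has_real_derivative psi lam w) (at w)"
  by (auto simp: phi_def[abs_def] psi_def intro!: derivative_eq_intros)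

lemma psi_derivative: "lam \<in> {1, -1} \<Longrightarrow> (psi lam has_real_derivative phi lam w) (at w)"
  by (auto simp: phi_def psi_def[abs_def] intro!: derivative_eq_intros)

lemma psi_phi_hyperbola: "lam \<in> {1, -1} \<Longrightarrow> (psi lam w)\<^sup>2 - (phi lam w)\<^sup>2 = of_int lam"
  by (auto simp: phi_def psi_def cosh_square_eq)

lemma mu_has_derivative:
  fixes p :: "real ^ 3"
  assumes lam: "lam \<in> {1, -1}"
  shows "((\<lambda>p. mu j lam i (p $ 2) (p $ 3)) has_derivative
     (\<lambda>u. mu_t j lam i (p $ 2) (p $ 3) * u $ 2 + mu_w j lam i (p $ 2) (p $ 3) * u $ 3)) (at p)"
proof -
  have 2: "((\<lambda>p. p $ 2) has_derivative (\<lambda>u. u $ 2)) (at p)"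
    and 3: "((\<lambda>p. p $ 3) has_derivative (\<lambda>u. u $ 3)) (at p)"
    by (auto intro!: bounded_linear_imp_has_derivative bounded_linear_vec_nth)
  note [derivative_intros] =
    DERIV_compose_FDERIV[OF phi_derivative[OF lam], OF 3]
    DERIV_compose_FDERIV[OF psi_derivative[OF lam], OF 3]
    DERIV_compose_FDERIV[OF has_field_derivative_cosh[OF DERIV_ident], OF 2]
    DERIV_compose_FDERIV[OF has_field_derivative_sinh[OF DERIV_ident], OF 2]
  show ?thesis
    unfolding mu_eq[OF lam] mu_t_def mu_w_def
    by (auto intro!: derivative_eq_intros simp: fun_eq_iff algebra_simps)
qed

lemma mu_has_partial_derivatives:
  assumes lam: "lam \<in> {1, -1}"
  shows "((\<lambda>t. mu j lam i t w) has_real_derivative mu_t j lam i t w) (at t)"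
    and "((\<lambda>w. mu j lam i t w) has_real_derivative mu_w j lam i t w) (at w)"
  unfolding mu_eq[OF lam] mu_t_def mu_w_def
  by (auto intro!: derivative_eq_intros phi_derivative[OF lam] psi_derivative[OF lam])

section \<open>Consequences of the gradient equations in t and w\<close>

lemma zero_on_open_imp_deriv_zero:
  fixes f :: "real \<Rightarrow> real"
  assumes "open S" "x \<in> S" "\<And>y. y \<in> S \<Longrightarrow> f y = 0" "(f has_real_derivative D) (at x)"
  shows "D = 0"
proof -
  have "(f has_real_derivative 0) (at x)"
    by (rule has_field_derivative_transform_within_open[of "\<lambda>_. 0", OF _ assms(1,2)])
      (use assms(3) in auto)
  with assms(4) show ?thesis by (rule DERIV_unique)
qed

text \<open>Both gradient equations say that \<open>(c2 - d / K, c3, c4)\<close> is normal to the quadric of the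
  coefficients, so \<open>(c3, c4)\<close> is proportional to \<open>(\<plusminus>\<mu>\<^sub>3, \<plusminus>\<mu>\<^sub>4)\<close> at every
  point; as \<open>c3\<close> and \<open>c4\<close> are constant, they vanish.\<close>

lemma gradient_proportional_mu2:
  fixes c2 c3 c4 d :: real
  assumes j: "j \<in> {2, 3, 4}" and lam: "lam \<in> {1, -1}"
    and op: "open S" "open T" and in0: "t0 \<in> S" "w0 \<in> T"
    and nz: "\<And>t w. t \<in> S \<Longrightarrow> w \<in> T \<Longrightarrow> K t w \<noteq> 0 \<and> phi lam w \<noteq> 0 \<and> t \<noteq> 0"
    and eq_t: "\<And>t w. t \<in> S \<Longrightarrow> w \<in> T \<Longrightarrow>
       K t w * (c2 * mu_t j lam 2 t w + c3 * mu_t j lam 3 t w + c4 * mu_t j lam 4 t w) = d * mu_t j lam 2 t w"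
    and eq_w: "\<And>t w. t \<in> S \<Longrightarrow> w \<in> T \<Longrightarrow>
       K t w * (c2 * mu_w j lam 2 t w + c3 * mu_w j lam 3 t w + c4 * mu_w j lam 4 t w) = d * mu_w j lam 2 t w"
  shows "c3 = 0" "c4 = 0"
proof -
  \<comment> \<open>For \<open>lam = -1\<close>, \<open>psi\<close> is sinh and may vanish at
    \<open>w0\<close>; differentiating in w replaces it by \<open>phi\<close>, which does not vanish
    there.\<close>
  have psi_zero: "x = 0" if "\<And>w. w \<in> T \<Longrightarrow> x * psi lam w = 0" for x
  proof -
    have "x * phi lam w0 = 0"
      by (rule zero_on_open_imp_deriv_zero[OF op(2) in0(2) that])
        (auto intro!: derivative_eq_intros psi_derivative[OF lam])
    then show ?thesis using nz[OF in0] by simp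
  qed
  \<comment> \<open>Here \<open>x\<close>, \<open>y\<close>, \<open>z\<close> belong to the indices
    j, j+1, j+2 (wrapped), and the relations say that (x, y, z) is parallel to (-phi cosh t, psi,
    phi sinh t). Each case below uses the relation that avoids index 2, whose entry is
    \<open>K t w * c2 - d\<close>.\<close>
  have normal: "z * cosh t = - x * sinh t" "x * psi lam w = - y * phi lam w * cosh t"
      "z * psi lam w = y * phi lam w * sinh t"
    if "phi lam w \<noteq> 0" "x * (phi lam w * sinh t) + z * (phi lam w * cosh t) = 0"
      "x * (psi lam w * cosh t) + y * phi lam w + z * (psi lam w * sinh t) = 0" for x y z t w
  proof -
    have "phi lam w * (x * sinh t + z * cosh t) = 0"
      using that(2) by (simp add: algebra_simps)
    then show 1: "z * cosh t = - x * sinh t"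
      using that(1) by simp
    have hyp: "cosh t * cosh t = 1 + sinh t * sinh t"
      using cosh_square_eq[of t] by (simp add: power2_eq_square)
    have "0 = cosh t * (x * (psi lam w * cosh t) + y * phi lam w + z * (psi lam w * sinh t))"
      using that(3) by simp
    also have "\<dots> = x * psi lam w * (cosh t * cosh t) + y * phi lam w * cosh t + psi lam w * sinh t * (z * cosh t)"
      by (simp add: algebra_simps)
    also have "\<dots> = x * psi lam w + y * phi lam w * cosh t"
      unfolding 1 hyp by (simp add: algebra_simps)
    finally show 2: "x * psi lam w = - y * phi lam w * cosh t" by simp
    have "cosh t * (z * psi lam w) = psi lam w * (z * cosh t)" by simp
    also have "\<dots> = - sinh t * (x * psi lam w)" unfolding 1 by simp
    also have "\<dots> = cosh t * (y * phi lam w * sinh t)" unfolding 2 by simp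
    finally show "z * psi lam w = y * phi lam w * sinh t" by simp
  qed
  consider "j = 2" | "j = 3" | "j = 4" using j by auto
  then have "c3 = 0 \<and> c4 = 0"
  proof cases
    case 1
    have rel: "c4 * psi lam w - c3 * phi lam w * sinh t = 0" if "t \<in> S" "w \<in> T" for t w
    proof -
      have "(K t w * c4) * psi lam w = (K t w * c3) * phi lam w * sinh t"
        by (rule normal(3)[of w "K t w * c2 - d"])
          (use nz[OF that] eq_t[OF that] eq_w[OF that] 1 in
            \<open>auto simp: mu_t_def mu_w_def wrap_def algebra_simps\<close>)
      then have "K t w * (c4 * psi lam w - c3 * phi lam w * sinh t) = 0"
        by (simp add: algebra_simps)
      then show ?thesis using nz[OF that] by simp
    qed
    have "- (c3 * phi lam w0 * cosh t0) = 0"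
      by (rule zero_on_open_imp_deriv_zero[OF op(1) in0(1), of "\<lambda>t. c4 * psi lam w0 - c3 * phi lam w0 * sinh t"])
        (use rel in0 in \<open>auto intro!: derivative_eq_intros\<close>)
    then have "c3 = 0" using nz[OF in0] by simp
    moreover from this have "c4 = 0" using psi_zero[of c4] rel[OF in0(1)] by simp
    ultimately show ?thesis by simp
  next
    case 2
    have rel: "c3 * psi lam w + c4 * phi lam w * cosh t = 0" if "t \<in> S" "w \<in> T" for t w
    proof -
      have "(K t w * c3) * psi lam w = - (K t w * c4) * phi lam w * cosh t"
        by (rule normal(2)[where z = "K t w * c2 - d"])
          (use nz[OF that] eq_t[OF that] eq_w[OF that] 2 in
            \<open>auto simp: mu_t_def mu_w_def wrap_def algebra_simps\<close>)
      then have "K t w * (c3 * psi lam w + c4 * phi lam w * cosh t) = 0"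
        by (simp add: algebra_simps)
      then show ?thesis using nz[OF that] by simp
    qed
    \<comment> \<open>Differentiation in t leaves sinh instead of cosh, so
      \<open>t0 \<noteq> 0\<close> is what gives \<open>c4 = 0\<close>.\<close>
    have "c4 * phi lam w0 * sinh t0 = 0"
      by (rule zero_on_open_imp_deriv_zero[OF op(1) in0(1), of "\<lambda>t. c3 * psi lam w0 + c4 * phi lam w0 * cosh t"])
        (use rel in0 in \<open>auto intro!: derivative_eq_intros\<close>)
    then have "c4 = 0" using nz[OF in0] by simp
    moreover from this have "c3 = 0" using psi_zero[of c3] rel[OF in0(1)] by simp
    ultimately show ?thesis by simp
  next
    case 3
    have rel: "c3 * cosh t + c4 * sinh t = 0" if "t \<in> S" "w \<in> T" for t w
    proof -
      have "(K t w * c3) * cosh t = - (K t w * c4) * sinh t"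
        by (rule normal(1)[of w _ _ _ "K t w * c2 - d"])
          (use nz[OF that] eq_t[OF that] eq_w[OF that] 3 in
            \<open>auto simp: mu_t_def mu_w_def wrap_def algebra_simps\<close>)
      then have "K t w * (c3 * cosh t + c4 * sinh t) = 0"
        by (simp add: algebra_simps)
      then show ?thesis using nz[OF that] by simp
    qed
    \<comment> \<open>The relation and its t-derivative form a linear system in \<open>c3\<close>,
      \<open>c4\<close> with determinant cosh^2 - sinh^2 = 1.\<close>
    have d: "c3 * sinh t0 + c4 * cosh t0 = 0"
      by (rule zero_on_open_imp_deriv_zero[OF op(1) in0(1), of "\<lambda>t. c3 * cosh t + c4 * sinh t"])
        (use rel in0 in \<open>auto intro!: derivative_eq_intros\<close>)
    have hyp: "cosh t0 * cosh t0 = 1 + sinh t0 * sinh t0"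
      using cosh_square_eq[of t0] by (simp add: power2_eq_square)
    have "c3 * (cosh t0 * cosh t0 - sinh t0 * sinh t0) =
        cosh t0 * (c3 * cosh t0 + c4 * sinh t0) - sinh t0 * (c3 * sinh t0 + c4 * cosh t0)"
      by (simp add: algebra_simps)
    then have "c3 = 0" using d rel[OF in0] hyp by simp
    then show ?thesis using d by simp
  qed
  then show "c3 = 0" "c4 = 0" by auto
qed

text \<open>For j = 2, 3, 4 the coefficient with index 2 is phi cosh t, phi sinh t, psi; the
  respective derivatives phi sinh t (in t), phi cosh t (in t), phi (in w) are non-zero.\<close>

lemma mu2_gradient_nonzero:
  assumes "j \<in> {2, 3, 4}" "phi lam w \<noteq> 0" "t \<noteq> 0"
  shows "mu_t j lam 2 t w \<noteq> 0 \<or> mu_w j lam 2 t w \<noteq> 0"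
  using assms by (auto simp: mu_t_def mu_w_def wrap_def)

section \<open>Principal curvatures\<close>

text \<open>The coordinate vectors with vanishing first entry are umbilic directions, because there
  \<open>L = r D\<close>; the remaining principal direction is mapped to a multiple of \<open>F\<close>.\<close>

lemma second_symmetric_function_of_curvatures:
  fixes X N :: "real ^ 3 \<Rightarrow> real ^ 4"
  assumes X: "(X has_derivative L) (at p)" and N: "(N has_derivative (\<lambda>u. - \<sigma> *\<^sub>R D u)) (at p)"
    and L: "\<And>u. L u = u $ 1 *\<^sub>R F + r *\<^sub>R D u" and inj: "inj L" and r: "r > 0"
    and \<sigma>: "\<sigma> * \<sigma> = 1" and F: "mink F F = 1" and f: "\<And>u. mink F (L u) = u $ 1 * f"
    and rangeF: "F \<in> range L"
  shows "curv_coeff X N 2 p = (3 - 2 / f) / r\<^sup>2" "f \<noteq> 0"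
proof -
  have frX: "frechet_derivative X (at p) = L" and frN: "frechet_derivative N (at p) = (\<lambda>u. - \<sigma> *\<^sub>R D u)"
    using X N by (simp_all add: frechet_derivative_at[symmetric])
  have linL: "linear L"
    using X has_derivative_linear by blast
  have rD: "D u = (1 / r) *\<^sub>R (L u - u $ 1 *\<^sub>R F)" for u
    using L r by simp
  obtain v3 where v3: "L v3 = F" using rangeF by auto
  have v31: "v3 $ 1 * f = 1" using f[of v3] v3 F by simp
  then show "f \<noteq> 0" by auto
  \<comment> \<open>\<open>principal_curvature\<close> is a \<open>SOME\<close> choice, so an
    eigenbasis must be exhibited before anything is known about the chosen values. The third
    eigenvalue comes from \<open>L v3 = F\<close> and
    \<open>r *\<^sub>R D v3 = (1 - v3 $ 1) *\<^sub>R F\<close>.\<close>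
  have ex: "are_principal_curvatures X N p (\<lambda>i. if i = 3 then \<sigma> / r * (1 - v3 $ 1) else \<sigma> / r)"
  proof -
    define v where "v = (\<lambda>i::nat. if i = 1 then axis 2 1 else if i = 2 then axis 3 1 else v3)"
    have v: "v 1 = axis 2 1" "v 2 = axis 3 1" "v 3 = v3" by (auto simp: v_def)
    have S: "{1..3} = {1, 2, 3::nat}" by auto
    have ne: "axis 2 1 \<noteq> (axis 3 1 :: real ^ 3)" "v3 \<noteq> axis 2 1" "v3 \<noteq> axis 3 1"
      using v31 by (simp add: axis_eq_axis, auto simp: axis_def)
    have injv: "inj_on v {1..3}"
      using ne by (auto simp: S v_def inj_on_def)
    have ind2: "independent {axis 2 1, axis 3 1 :: real ^ 3}"
      by (rule independent_mono[OF independent_Basis]) (auto simp: axis_in_Basis_iff)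
    have "span {axis 2 1, axis 3 1} \<subseteq> {u :: real ^ 3. u $ 1 = 0}"
      by (rule span_minimal) (auto simp: subspace_def axis_def)
    then have "v3 \<notin> span {axis 2 1, axis 3 1}"
      using v31 by auto
    then have "independent (insert v3 {axis 2 1, axis 3 1})"
      using ind2 by (simp add: independent_insert)
    moreover have "v ` {1..3} = insert v3 {axis 2 1, axis 3 1}"
      unfolding S image_insert image_empty v by auto
    ultimately have indv: "independent (v ` {1..3})" by simp
    have "(axis 2 1 :: real ^ 3) $ 1 = 0" "(axis 3 1 :: real ^ 3) $ 1 = 0"
      by (simp_all add: axis_def)
    then have "\<forall>i\<in>{1..3}. - frechet_derivative N (at p) (v i) =
        (if i = 3 then \<sigma> / r * (1 - v3 $ 1) else \<sigma> / r) *\<^sub>R frechet_derivative X (at p) (v i)"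
      unfolding S frX frN rD by (simp add: v v(1)[unfolded One_nat_def] v3 algebra_simps)
    then show ?thesis
      unfolding are_principal_curvatures_def using injv indv by blast
  qed
  define \<kappa> where "\<kappa> = principal_curvature X N p"
  have "are_principal_curvatures X N p \<kappa>"
    unfolding \<kappa>_def principal_curvature_def by (rule someI[of "are_principal_curvatures X N p"], rule ex)
  then obtain v where injv: "inj_on v {1..3}" and indv: "independent (v ` {1..3})"
    and ev: "\<And>i. i \<in> {1..3} \<Longrightarrow> - frechet_derivative N (at p) (v i) = \<kappa> i *\<^sub>R frechet_derivative X (at p) (v i)"
    unfolding are_principal_curvatures_def by blast
  \<comment> \<open>The chosen eigenbasis may differ from the exhibited one, so its eigenvalues are
    computed afresh. In terms of \<open>y\<close> the umbilic value \<sigma> / r becomes 0 and the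
    remaining one becomes 1 / f.\<close>
  define y where "y i = 1 - r * \<sigma> * \<kappa> i" for i
  have \<kappa>y: "\<kappa> i = \<sigma> / r * (1 - y i)" for i
    using r \<sigma> by (simp add: y_def)
  have yL: "y i *\<^sub>R L (v i) = v i $ 1 *\<^sub>R F" if "i \<in> {1..3}" for i
  proof -
    have "\<sigma> *\<^sub>R D (v i) = \<kappa> i *\<^sub>R L (v i)"
      using ev[OF that] by (simp add: frX frN)
    then have "(r * \<sigma>) *\<^sub>R \<sigma> *\<^sub>R D (v i) = (r * \<sigma> * \<kappa> i) *\<^sub>R L (v i)"
      by simp
    then have "(r * \<sigma> * \<kappa> i) *\<^sub>R L (v i) = r *\<^sub>R D (v i)"
      using \<sigma> by (simp add: mult.assoc)
    also have "\<dots> = L (v i) - v i $ 1 *\<^sub>R F"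
      using L by simp
    finally show ?thesis by (simp add: y_def algebra_simps)
  qed
  have ynz: "y i = 1 / f" if "i \<in> {1..3}" "v i $ 1 \<noteq> 0" for i
  proof -
    have "y i * (v i $ 1 * f) = v i $ 1"
      using arg_cong[OF yL[OF that(1)], of "mink F"] f F by (simp add: mink.scaleR_right)
    then show ?thesis using that(2) \<open>f \<noteq> 0\<close> by (simp add: field_simps)
  qed
  have yz: "y i = 0" if "i \<in> {1..3}" "v i $ 1 = 0" for i
  proof -
    have "v i \<noteq> 0" using indv that(1) dependent_zero by (metis imageI)
    then have "L (v i) \<noteq> 0" using linL inj by (metis linear_injective_0)
    then show ?thesis using yL[OF that(1)] that(2) by simp
  qed
  \<comment> \<open>Two eigenvectors with non-zero first entry would both be mapped to multiples of
    \<open>F\<close>, hence be parallel, against independence.\<close>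
  have unique: "v l $ 1 = 0" if il: "i \<in> {1..3}" "l \<in> {1..3}" "i \<noteq> l" "v i $ 1 \<noteq> 0" for i l
  proof (rule ccontr)
    assume l: "v l $ 1 \<noteq> 0"
    have "L (v i) = (f * v i $ 1) *\<^sub>R F" "L (v l) = (f * v l $ 1) *\<^sub>R F"
      using yL[OF il(1)] yL[OF il(2)] ynz il l \<open>f \<noteq> 0\<close>
      by (metis (no_types, lifting) divide_inverse mult_1 scaleR_scaleR scaleR_one right_inverse)+
    then have "L (v l $ 1 *\<^sub>R v i) = L (v i $ 1 *\<^sub>R v l)"
      using linL by (simp add: linear_cmul)
    then have eq: "v l $ 1 *\<^sub>R v i = v i $ 1 *\<^sub>R v l"
      using inj by (simp add: inj_eq)
    have "v i = (1 / v l $ 1) *\<^sub>R (v l $ 1 *\<^sub>R v i)" using l by simp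
    then have "v i \<in> span {v l}"
      unfolding eq by (metis scaleR_scaleR span_base span_scale singletonI)
    moreover have "v l \<in> v ` {1..3} - {v i}"
      using il injv by (auto simp: inj_on_def)
    ultimately have "v i \<in> span (v ` {1..3} - {v i})"
      by (meson empty_subsetI insert_subset span_mono subsetD)
    then show False
      using indv il(1) unfolding dependent_def by blast
  qed
  \<comment> \<open>An eigenbasis spans the whole space and cannot lie in the plane of vanishing
    first entry. So exactly one \<open>y i\<close> equals 1 / f.\<close>
  have "\<exists>i\<in>{1..3}. v i $ 1 \<noteq> 0"
  proof (rule ccontr)
    assume "\<not> ?thesis"
    then have "v ` {1..3} \<subseteq> {u. u $ 1 = 0}" by auto
    then have "span (v ` {1..3}) \<subseteq> {u. u $ 1 = 0}"
      by (rule span_minimal) (auto simp: subspace_def)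
    moreover have "card (v ` {1..3}) = 3"
      using injv by (simp add: card_image)
    then have "UNIV \<subseteq> span (v ` {1..3})"
      using card_ge_dim_independent[of "v ` {1..3}" UNIV] indv by simp
    ultimately have "(axis 1 1 :: real ^ 3) \<in> {u. u $ 1 = 0}" by blast
    then show False by (simp add: axis_def)
  qed
  then obtain i0 where i0: "i0 \<in> {1..3}" "v i0 $ 1 \<noteq> 0" by blast
  have yi: "y i = (if i = i0 then 1 / f else 0)" if "i \<in> {1..3}" for i
    using that i0 ynz yz unique by auto
  have sets: "{A. A \<subseteq> {1..3} \<and> card A = 2} = {{1, 2}, {1, 3}, {2, 3::nat}}"
  proof -
    have "A \<in> {{1, 2}, {1, 3}, {2, 3}}" if "A \<subseteq> {1..3}" "card A = 2" for A :: "nat set"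
    proof -
      obtain a b where "A = {a, b}" "a \<noteq> b" using \<open>card A = 2\<close> by (meson card_2_iff)
      moreover have "{1..3} = {1, 2, 3::nat}" by auto
      ultimately show ?thesis using that(1) by auto
    qed
    then show ?thesis by auto
  qed
  have "curv_coeff X N 2 p = \<kappa> 1 * \<kappa> 2 + \<kappa> 1 * \<kappa> 3 + \<kappa> 2 * \<kappa> 3"
  proof -
    have "{1, 2} \<noteq> {1, 3::nat}" "{1, 2} \<noteq> {2, 3::nat}" "{1, 3} \<noteq> {2, 3::nat}" by auto
    then show ?thesis
      unfolding curv_coeff_def sets \<kappa>_def by simp
  qed
  also have "\<dots> = (\<sigma> * \<sigma>) / r\<^sup>2 *
      ((1 - y 1) * (1 - y 2) + (1 - y 1) * (1 - y 3) + (1 - y 2) * (1 - y 3))"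
  proof -
    have "(\<sigma> / r * a) * (\<sigma> / r * b) = (\<sigma> * \<sigma>) / r\<^sup>2 * (a * b)" for a b
      by (simp add: power2_eq_square)
    then show ?thesis
      unfolding \<kappa>y by (simp only: distrib_left)
  qed
  also have "(1 - y 1) * (1 - y 2) + (1 - y 1) * (1 - y 3) + (1 - y 2) * (1 - y 3) = 3 - 2 / f"
  proof -
    have "i0 = 1 \<or> i0 = 2 \<or> i0 = 3" using i0(1) by auto
    then show ?thesis by (auto simp: yi)
  qed
  finally show "curv_coeff X N 2 p = (3 - 2 / f) / r\<^sup>2"
    using \<sigma> by simp
qed

section \<open>The tubular hypersurface\<close>

lemma sum_2_4: "(\<Sum>i = 2..4. g i) = g 2 + g 3 + (g (4::nat) :: 'a :: comm_monoid_add)"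
proof -
  have "{2..4} = {2, 3, 4::nat}" by auto
  then show ?thesis by (simp add: add.assoc)
qed

lemma smooth_on_imp_differentiable: "smooth_on U f \<Longrightarrow> p \<in> U \<Longrightarrow> f differentiable (at p)"
  unfolding smooth_on_def by (metis Ck_on.simps(2))

lemma smooth_on_imp_continuous_on: "smooth_on U f \<Longrightarrow> continuous_on U f"
  unfolding smooth_on_def by (metis Ck_on.simps(1))

lemma open_contains_box3:
  fixes W :: "(real ^ 3) set"
  assumes "open W" "p \<in> W"
  obtains e where "e > 0" "\<And>s t w. \<bar>s - p $ 1\<bar> < e \<Longrightarrow> \<bar>t - p $ 2\<bar> < e \<Longrightarrow> \<bar>w - p $ 3\<bar> < e \<Longrightarrow>
    vector [s, t, w] \<in> W"
proof -
  obtain d where d: "d > 0" "ball p d \<subseteq> W"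
    using assms open_contains_ball by blast
  have "vector [s, t, w] \<in> W" if "\<bar>s - p $ 1\<bar> < d / 3" "\<bar>t - p $ 2\<bar> < d / 3" "\<bar>w - p $ 3\<bar> < d / 3" for s t w
  proof -
    have "norm (vector [s, t, w] - p) \<le> \<bar>s - p $ 1\<bar> + \<bar>t - p $ 2\<bar> + \<bar>w - p $ 3\<bar>"
      using norm_le_l1_cart[of "vector [s, t, w] - p"] by (simp add: sum_3)
    then have "dist p (vector [s, t, w]) < d"
      using that by (simp add: dist_norm norm_minus_commute)
    then show ?thesis using d by auto
  qed
  then show ?thesis
    using d(1) by (intro that[of "d / 3"]) auto
qed

lemma open_meets_nonzero_coordinate:
  fixes W :: "(real ^ 3) set"
  assumes "open W" "W \<noteq> {}"
  shows "\<exists>p\<in>W. p $ 2 \<noteq> 0"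
proof -
  obtain p where p: "p \<in> W" using assms by blast
  obtain e where "e > 0" and e: "\<And>s t w. \<bar>s - p $ 1\<bar> < e \<Longrightarrow> \<bar>t - p $ 2\<bar> < e \<Longrightarrow> \<bar>w - p $ 3\<bar> < e \<Longrightarrow>
      vector [s, t, w] \<in> W"
    using open_contains_box3[OF assms(1) p] by blast
  let ?t = "if p $ 2 = 0 then e / 2 else p $ 2"
  have "vector [p $ 1, ?t, p $ 3] \<in> W"
    using \<open>e > 0\<close> by (intro e) auto
  then show ?thesis
    using \<open>e > 0\<close> by (intro bexI[of _ "vector [p $ 1, ?t, p $ 3]"]) auto
qed

section \<open>Setting and coordinate formulas\<close>

locale frenet_tube =
  fixes j :: nat and lam :: int and r :: real
    and I :: "real set" and \<beta> :: "real \<Rightarrow> real ^ 4"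
    and F :: "nat \<Rightarrow> real \<Rightarrow> real ^ 4" and k :: "nat \<Rightarrow> real \<Rightarrow> real"
    and U :: "(real ^ 3) set"
  assumes j: "j \<in> {2, 3, 4}" and lam: "lam \<in> {1, -1}" and r: "r > 0"
    and open_I: "open I" and frenet: "frenet_curve I j \<beta> F k"
    and open_U: "open U" and U_I: "\<And>p. p \<in> U \<Longrightarrow> p $ 1 \<in> I"
    and immersion: "immersion_on U (tube j lam r \<beta> F)"
begin

text \<open>The value is 1 for j = 2 and -1 for j = 3, 4: the sign of the \<open>F 1\<close> term in
  the Frenet equation for \<open>F 2\<close>.\<close>

definition \<eta> :: real where "\<eta> = (-1) ^ fact (4 - j)"

text \<open>Keeping the frame derivatives unexpanded gives one formula for \<open>DG\<close> in all
  three Frenet systems.\<close>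

definition E :: "nat \<Rightarrow> real \<Rightarrow> real ^ 4" where "E i s = vector_derivative (F i) (at s)"

definition G :: "real ^ 3 \<Rightarrow> real ^ 4" where
  "G p = (\<Sum>i = 2..4. mu j lam i (p $ 2) (p $ 3) *\<^sub>R F i (p $ 1))"

definition DG :: "real ^ 3 \<Rightarrow> real ^ 3 \<Rightarrow> real ^ 4" where
  "DG p u = (\<Sum>i = 2..4. mu j lam i (p $ 2) (p $ 3) *\<^sub>R u $ 1 *\<^sub>R E i (p $ 1) +
     (mu_t j lam i (p $ 2) (p $ 3) * u $ 2 + mu_w j lam i (p $ 2) (p $ 3) * u $ 3) *\<^sub>R F i (p $ 1))"

definition DX :: "real ^ 3 \<Rightarrow> real ^ 3 \<Rightarrow> real ^ 4" where
  "DX p u = u $ 1 *\<^sub>R F 1 (p $ 1) + r *\<^sub>R DG p u"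

definition f :: "real ^ 3 \<Rightarrow> real" where
  "f p = 1 + r * \<eta> * k 1 (p $ 1) * mu j lam 2 (p $ 2) (p $ 3)"

definition Df :: "real ^ 3 \<Rightarrow> real ^ 3 \<Rightarrow> real" where
  "Df p u = r * \<eta> * (u $ 1 * deriv (k 1) (p $ 1) * mu j lam 2 (p $ 2) (p $ 3) + k 1 (p $ 1) *
     (mu_t j lam 2 (p $ 2) (p $ 3) * u $ 2 + mu_w j lam 2 (p $ 2) (p $ 3) * u $ 3))"

lemma eta_square: "\<eta> * \<eta> = 1"
  using j by (auto simp: \<eta>_def fact_numeral)

lemma eta_lam_square: "(\<eta> * of_int lam ^ j) * (\<eta> * of_int lam ^ j) = 1"
  using j lam eta_square by (auto simp: algebra_simps)

lemma tube_eq: "tube j lam r \<beta> F p = \<beta> (p $ 1) + r *\<^sub>R G p"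
  by (simp add: tube_def G_def)

lemma tube_normal_eq: "tube_normal j lam F p = - (\<eta> * of_int lam ^ j) *\<^sub>R G p"
  by (simp add: tube_normal_def G_def \<eta>_def)

lemma frame:
  "s \<in> I \<Longrightarrow> i \<in> {1..4} \<Longrightarrow> l \<in> {1..4} \<Longrightarrow>
    mink (F i s) (F l s) = (if i \<noteq> l then 0 else if i = j then -1 else 1)"
  using frenet unfolding frenet_curve_def by blast

lemma F_derivative:
  assumes "s \<in> I" "i \<in> {1..4}"
  shows "(F i has_vector_derivative E i s) (at s)"
proof -
  have "smooth_on I (F i)"
    using frenet assms(2) unfolding frenet_curve_def by blast
  then show ?thesis
    unfolding E_def using assms(1) smooth_on_imp_differentiable vector_derivative_works by blast
qed

lemma k1_derivative:
  assumes "s \<in> I"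
  shows "(k 1 has_real_derivative deriv (k 1) s) (at s)"
proof -
  have "smooth_on I (k 1)"
    using frenet unfolding frenet_curve_def by simp
  then show ?thesis
    using assms smooth_on_imp_differentiable DERIV_deriv_iff_real_differentiable by blast
qed

lemma beta_derivative: "s \<in> I \<Longrightarrow> (\<beta> has_vector_derivative F 1 s) (at s)"
  using frenet unfolding frenet_curve_def by blast

lemma frenet_equations:
  assumes s: "s \<in> I"
  shows "E 1 s = k 1 s *\<^sub>R F 2 s" "E 2 s = (\<eta> * k 1 s) *\<^sub>R F 1 s + k 2 s *\<^sub>R F 3 s"
    "mink (F 1 s) (E 3 s) = 0" "mink (F 1 s) (E 4 s) = 0"
proof -
  have E: "E i s = V" if "(F i has_vector_derivative V) (at s)" for i V
    unfolding E_def using that by (rule vector_derivative_at)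
  show "E 1 s = k 1 s *\<^sub>R F 2 s"
    using j frenet s by (intro E) (auto simp: frenet_curve_def)
  have "(F 2 has_vector_derivative (\<eta> * k 1 s) *\<^sub>R F 1 s + k 2 s *\<^sub>R F 3 s) (at s)"
    using j frenet s by (auto simp: frenet_curve_def \<eta>_def fact_numeral)
  then show "E 2 s = (\<eta> * k 1 s) *\<^sub>R F 1 s + k 2 s *\<^sub>R F 3 s" by (rule E)
  have "(F 3 has_vector_derivative k 2 s *\<^sub>R F 2 s + k 3 s *\<^sub>R F 4 s) (at s) \<or>
      (F 3 has_vector_derivative - k 2 s *\<^sub>R F 2 s + k 3 s *\<^sub>R F 4 s) (at s)"
    using j frenet s unfolding frenet_curve_def by blast
  then have "E 3 s = k 2 s *\<^sub>R F 2 s + k 3 s *\<^sub>R F 4 s \<or> E 3 s = - k 2 s *\<^sub>R F 2 s + k 3 s *\<^sub>R F 4 s"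
    using E by blast
  then show "mink (F 1 s) (E 3 s) = 0"
    using frame[OF s] by (auto simp: mink.add_right mink.diff_right mink.minus_right mink.scaleR_right)
  have "(F 4 has_vector_derivative k 3 s *\<^sub>R F 3 s) (at s) \<or>
      (F 4 has_vector_derivative - k 3 s *\<^sub>R F 3 s) (at s)"
    using j frenet s unfolding frenet_curve_def by blast
  then have "E 4 s = k 3 s *\<^sub>R F 3 s \<or> E 4 s = - k 3 s *\<^sub>R F 3 s"
    using E by blast
  then show "mink (F 1 s) (E 4 s) = 0"
    using frame[OF s] by (auto simp: mink.minus_right mink.scaleR_right)
qed

section \<open>Differentials of the tube, of its normal and of \<open>f\<close>\<close>

lemma has_derivative_along_s:
  assumes "(h has_vector_derivative V) (at ((p :: real ^ 3) $ 1))"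
  shows "((\<lambda>p. h (p $ 1)) has_derivative (\<lambda>u. u $ 1 *\<^sub>R V)) (at p)"
proof -
  have "((\<lambda>p :: real ^ 3. p $ 1) has_derivative (\<lambda>u. u $ 1)) (at p)"
    by (intro bounded_linear_imp_has_derivative bounded_linear_vec_nth)
  then show ?thesis
    using assms unfolding has_vector_derivative_def by (rule has_derivative_compose)
qed

lemma G_has_derivative:
  assumes "p $ 1 \<in> I"
  shows "(G has_derivative DG p) (at p)"
  unfolding G_def[abs_def] DG_def[abs_def]
proof (rule has_derivative_sum)
  fix i :: nat assume "i \<in> {2..4}"
  then have "(F i has_vector_derivative E i (p $ 1)) (at (p $ 1))"
    using assms by (intro F_derivative) auto
  from has_derivative_scaleR[OF mu_has_derivative[OF lam] has_derivative_along_s[OF this]]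
  show "((\<lambda>p. mu j lam i (p $ 2) (p $ 3) *\<^sub>R F i (p $ 1)) has_derivative
      (\<lambda>u. mu j lam i (p $ 2) (p $ 3) *\<^sub>R u $ 1 *\<^sub>R E i (p $ 1) +
        (mu_t j lam i (p $ 2) (p $ 3) * u $ 2 + mu_w j lam i (p $ 2) (p $ 3) * u $ 3) *\<^sub>R F i (p $ 1))) (at p)"
    .
qed

lemma tube_has_derivative:
  assumes "p $ 1 \<in> I"
  shows "(tube j lam r \<beta> F has_derivative DX p) (at p)"
proof -
  have "((\<lambda>p. \<beta> (p $ 1) + r *\<^sub>R G p) has_derivative (\<lambda>u. u $ 1 *\<^sub>R F 1 (p $ 1) + r *\<^sub>R DG p u)) (at p)"
    using assms by (intro has_derivative_add has_derivative_scaleR_right has_derivative_along_s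
        beta_derivative G_has_derivative)
  then show ?thesis
    by (simp add: tube_eq[abs_def] DX_def[abs_def])
qed

lemma tube_normal_has_derivative:
  assumes "p $ 1 \<in> I"
  shows "(tube_normal j lam F has_derivative (\<lambda>u. - (\<eta> * of_int lam ^ j) *\<^sub>R DG p u)) (at p)"
  unfolding tube_normal_eq[abs_def]
  using assms by (intro has_derivative_scaleR_right G_has_derivative)

lemma f_has_derivative:
  assumes "p $ 1 \<in> I"
  shows "(f has_derivative Df p) (at p)"
proof -
  have "(k 1 has_vector_derivative deriv (k 1) (p $ 1)) (at (p $ 1))"
    using k1_derivative[OF assms] by (simp add: has_real_derivative_iff_has_vector_derivative)
  note k = has_derivative_along_s[OF this]
  from has_derivative_add[OF has_derivative_const[of 1] has_derivative_mult_right[OF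
      has_derivative_mult[OF k mu_has_derivative[OF lam]], of "r * \<eta>"]]
  show ?thesis
    unfolding f_def[abs_def] Df_def[abs_def] by (simp add: algebra_simps)
qed

text \<open>The timelike index j carries phi cosh t, so the sum is -phi^2 cosh^2 t + psi^2 + phi^2
  sinh^2 t = psi^2 - phi^2.\<close>

lemma mink_G_G:
  assumes "p $ 1 \<in> I"
  shows "mink (G p) (G p) = of_int lam"
proof -
  let ?m = "\<lambda>i. mu j lam i (p $ 2) (p $ 3)"
  let ?e = "\<lambda>i. if i = j then -1 else 1 :: real"
  have "mink (G p) (G p) = ?e 2 * (?m 2)\<^sup>2 + ?e 3 * (?m 3)\<^sup>2 + ?e 4 * (?m 4)\<^sup>2"
    using frame[OF assms]
    by (simp add: G_def sum_2_4 mink.add_left mink.add_right mink.scaleR_left mink.scaleR_right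
        power2_eq_square)
  also have "\<dots> = (psi lam (p $ 3))\<^sup>2 - (phi lam (p $ 3))\<^sup>2"
    using j by (auto simp: mu_eq[OF lam] wrap_def power_mult_distrib cosh_square_eq algebra_simps)
  finally show ?thesis
    using psi_phi_hyperbola[OF lam] by simp
qed

lemma mink_F1_G: "p $ 1 \<in> I \<Longrightarrow> mink (F 1 (p $ 1)) (G p) = 0"
  using frame by (simp add: G_def sum_2_4 mink.add_right mink.scaleR_right)

text \<open>Since \<open>mink (G q) (G q)\<close> is constant on an open set, its differential
  vanishes and \<open>DG\<close> is orthogonal to \<open>G\<close>; so is
  \<open>F 1\<close>.\<close>

lemma mink_DX_G:
  assumes p: "p $ 1 \<in> I"
  shows "mink (DX p u) (G p) = 0"
proof -
  have op: "open {q :: real ^ 3. q $ 1 \<in> I}"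
    using open_I by (simp add: open_vimage_vec_nth vimage_def[symmetric])
  have "((\<lambda>q. mink (G q) (G q)) has_derivative (\<lambda>u. mink (G p) (DG p u) + mink (DG p u) (G p))) (at p)"
    by (rule mink.FDERIV[OF G_has_derivative[OF p] G_has_derivative[OF p]])
  moreover have "((\<lambda>q. mink (G q) (G q)) has_derivative (\<lambda>u. 0)) (at p)"
    by (rule has_derivative_transform_within_open[OF has_derivative_const[of "of_int lam"] op])
      (use p mink_G_G in auto)
  ultimately have "(\<lambda>u. mink (G p) (DG p u) + mink (DG p u) (G p)) = (\<lambda>u. 0)"
    by (rule has_derivative_unique)
  then have "mink (DG p u) (G p) = 0"
    by (metis mink_commute double_zero)
  then show ?thesis
    using mink_F1_G[OF p] by (simp add: DX_def mink.add_left mink.scaleR_left)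
qed

text \<open>Among the frame derivatives only \<open>E 2\<close> has an \<open>F 1\<close> component,
  namely \<eta> \<open>k 1\<close>; this is the origin of \<open>f\<close>.\<close>

lemma mink_F1_DX:
  assumes p: "p $ 1 \<in> I"
  shows "mink (F 1 (p $ 1)) (DX p u) = u $ 1 * f p"
  using frenet_equations[OF p] frame[OF p] j
  by (auto simp: DX_def DG_def sum_2_4 f_def mink.add_right mink.scaleR_right algebra_simps)

lemma inj_DX: "p \<in> U \<Longrightarrow> inj (DX p)"
  using immersion tube_has_derivative[OF U_I] frechet_derivative_at
  unfolding immersion_on_def by metis

text \<open>Every t-derivative \<open>mu_t\<close> carries the factor \<open>phi\<close>, so at a
  zero of \<open>phi\<close> the tube would not be an immersion.\<close>

lemma phi_nonzero:
  assumes p: "p \<in> U"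
  shows "phi lam (p $ 3) \<noteq> 0"
proof
  assume "phi lam (p $ 3) = 0"
  then have "DX p (axis 2 1) = 0"
    by (simp add: DX_def DG_def sum_2_4 mu_t_def axis_def)
  moreover have "DX p 0 = 0"
    by (simp add: DX_def DG_def)
  ultimately have "axis 2 1 = (0 :: real ^ 3)"
    using inj_DX[OF p] by (metis injD)
  then show False by (simp add: axis_eq_0_iff)
qed

text \<open>Being orthogonal to \<open>G\<close>, \<open>F 1\<close> is tangent, as the curvature
  computation requires. The sign (-lam)^2 is 1.\<close>

lemma second_mean_curvature:
  assumes p: "p \<in> U"
  shows "mean_curv (tube j lam r \<beta> F) (tube_normal j lam F) 2 p = (3 - 2 / f p) / (3 * r\<^sup>2)" "f p \<noteq> 0"
proof -
  note pI = U_I[OF p]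
  have "G p \<noteq> 0"
    using mink_G_G[OF pI] lam by (auto simp: mink.zero_left)
  then have R: "range (DX p) = {v. mink v (G p) = 0}"
    using has_derivative_linear[OF tube_has_derivative[OF pI]] inj_DX[OF p] mink_DX_G[OF pI]
    by (intro range_eq_mink_complement)
  have F1: "mink (F 1 (p $ 1)) (F 1 (p $ 1)) = 1" "F 1 (p $ 1) \<in> range (DX p)"
    using frame[OF pI] j mink_F1_G[OF pI] by (auto simp: R)
  note * = second_symmetric_function_of_curvatures[OF tube_has_derivative[OF pI]
      tube_normal_has_derivative[OF pI] DX_def inj_DX[OF p] r eta_lam_square F1(1) mink_F1_DX[OF pI] F1(2)]
  show "f p \<noteq> 0" by (rule *(2))
  have "mink (tube_normal j lam F p) (tube_normal j lam F p) =
      (\<eta> * of_int lam ^ j) * (\<eta> * of_int lam ^ j) * of_int lam"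
    unfolding tube_normal_eq mink.scaleR_left mink.scaleR_right mink_G_G[OF pI] by simp
  then have "mink (tube_normal j lam F p) (tube_normal j lam F p) = of_int lam"
    unfolding eta_lam_square by simp
  moreover have "3 choose 2 = (3::nat)" by (simp add: numeral_eq_Suc)
  ultimately show "mean_curv (tube j lam r \<beta> F) (tube_normal j lam F) 2 p = (3 - 2 / f p) / (3 * r\<^sup>2)"
    using lam *(1) by (auto simp: mean_curv_def)
qed

lemma second_mean_curvature_has_derivative:
  assumes p: "p \<in> U"
  shows "(mean_curv (tube j lam r \<beta> F) (tube_normal j lam F) 2 has_derivative
    (\<lambda>u. 2 / (3 * r\<^sup>2 * (f p)\<^sup>2) * Df p u)) (at p)"
proof (rule has_derivative_transform_within_open[OF _ open_U p])
  have f: "f p \<noteq> 0" using second_mean_curvature[OF p] by simp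
  have "((\<lambda>p. 2 * inverse (f p)) has_derivative (\<lambda>u. 2 * - (inverse (f p) * Df p u * inverse (f p)))) (at p)"
    by (intro derivative_intros f_has_derivative f U_I p)
  from has_derivative_mult_right[OF has_derivative_diff[OF has_derivative_const[of 3] this], of "1 / (3 * r\<^sup>2)"]
  show "((\<lambda>p. (3 - 2 / f p) / (3 * r\<^sup>2)) has_derivative (\<lambda>u. 2 / (3 * r\<^sup>2 * (f p)\<^sup>2) * Df p u)) (at p)"
    by (simp add: field_simps power2_eq_square)
qed (simp add: second_mean_curvature)

text \<open>Pairing with tangent vectors removes the normal part of \<open>L1 N\<close>.\<close>

lemma tangential_equation:
  assumes p: "p \<in> U"
    and eq: "L1_gauss (tube j lam r \<beta> F) (tube_normal j lam F) p = m *\<^sub>R tube_normal j lam F p + n *\<^sub>R C"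
  shows "n * (f p)\<^sup>2 * r\<^sup>2 * mink C (DX p u) = 2 * Df p u"
proof -
  note pI = U_I[OF p]
  let ?X = "tube j lam r \<beta> F" and ?N = "tube_normal j lam F"
  let ?H = "mean_curv ?X ?N 2"
  have fr: "frechet_derivative ?X (at p) = DX p"
      "frechet_derivative ?H (at p) = (\<lambda>u. 2 / (3 * r\<^sup>2 * (f p)\<^sup>2) * Df p u)"
    using tube_has_derivative[OF pI] second_mean_curvature_has_derivative[OF p]
    by (simp_all add: frechet_derivative_at[symmetric])
  have tang: "mink (?N p) (DX p u) = 0" for u
    using mink_DX_G[OF pI, of u] mink_commute[of "G p"]
    by (simp add: tube_normal_eq mink.scaleR_left mink.minus_left)
  have grad: "mink (grad ?X ?H p) (DX p u) = 2 / (3 * r\<^sup>2 * (f p)\<^sup>2) * Df p u"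
  proof -
    have "?X differentiable (at p)" "?H differentiable (at p)"
      using tube_has_derivative[OF pI] second_mean_curvature_has_derivative[OF p] by (auto intro: differentiableI)
    moreover have "mink (G p) (G p) \<noteq> 0"
      using mink_G_G[OF pI] lam by auto
    ultimately show ?thesis
      using mink_grad[of ?X p "G p" ?H u, unfolded fr] inj_DX[OF p] mink_DX_G[OF pI] by blast
  qed
  \<comment> \<open>The prefactor of \<open>L1_gauss\<close> is 3 times this square, hence
    3.\<close>
  have NN: "mink (?N p) (?N p) * mink (?N p) (?N p) = 1"
  proof -
    have "mink (?N p) (?N p) = (\<eta> * of_int lam ^ j) * (\<eta> * of_int lam ^ j) * of_int lam"
      unfolding tube_normal_eq mink.scaleR_left mink.scaleR_right mink_G_G[OF pI] by simp
    then show ?thesis unfolding eta_lam_square using lam by auto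
  qed
  have "3 choose 2 = (3::nat)" by (simp add: numeral_eq_Suc)
  then have "L1_gauss ?X ?N p = (3 * (mink (?N p) (?N p) * mink (?N p) (?N p))) *\<^sub>R
      (grad ?X ?H p + (3 * mean_curv ?X ?N 1 p * ?H p - mean_curv ?X ?N 3 p) *\<^sub>R ?N p)"
    unfolding L1_gauss_def Let_def by (simp add: mult.left_commute mult.commute)
  then have "mink (L1_gauss ?X ?N p) (DX p u) = 3 * (2 / (3 * r\<^sup>2 * (f p)\<^sup>2) * Df p u)"
    unfolding NN by (simp add: mink.add_left mink.scaleR_left tang grad)
  moreover have "mink (L1_gauss ?X ?N p) (DX p u) = n * mink C (DX p u)"
    unfolding eq by (simp add: mink.add_left mink.scaleR_left tang)
  ultimately have "n * mink C (DX p u) = 2 / (r\<^sup>2 * (f p)\<^sup>2) * Df p u"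
    by simp
  then show ?thesis
    using r second_mean_curvature(2)[OF p] by (simp add: field_simps)
qed

section \<open>Elimination on a coordinate box\<close>

lemma not_generalized_L1_1type_gauss:
  "\<not> generalized_L1_1type_gauss U (tube j lam r \<beta> F) (tube_normal j lam F)"
proof
  assume "generalized_L1_1type_gauss U (tube j lam r \<beta> F) (tube_normal j lam F)"
  then obtain m n C where smooth_n: "smooth_on U n" and n: "\<exists>p\<in>U. n p \<noteq> 0" and C: "C \<noteq> 0"
    and eq: "\<And>p. p \<in> U \<Longrightarrow> L1_gauss (tube j lam r \<beta> F) (tube_normal j lam F) p =
      m p *\<^sub>R tube_normal j lam F p + n p *\<^sub>R C"
    unfolding generalized_L1_1type_gauss_def by blast
  define W where "W = {p \<in> U. n p \<noteq> 0}"
  have "open W"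
    using continuous_open_preimage[OF smooth_on_imp_continuous_on[OF smooth_n] open_U, of "- {0}"]
    by (simp add: W_def vimage_def Int_def open_Compl)
  have "W \<noteq> {}" using n by (auto simp: W_def)
  txt \<open>The gradient of \<open>\<mu>\<^sub>2\<close> can vanish only where \<open>t = 0\<close>.\<close>
  obtain p0 where p0: "p0 \<in> W" "p0 $ 2 \<noteq> 0"
    using open_meets_nonzero_coordinate[OF \<open>open W\<close> \<open>W \<noteq> {}\<close>] by blast
  have "open (W \<inter> {p. p $ 2 \<noteq> 0})"
    using open_vimage_vec_nth[of "- {0 :: real}" 2] \<open>open W\<close> by (auto simp: vimage_def)
  then obtain e where e: "e > 0" and box: "\<And>s t w. \<bar>s - p0 $ 1\<bar> < e \<Longrightarrow> \<bar>t - p0 $ 2\<bar> < e \<Longrightarrow>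
      \<bar>w - p0 $ 3\<bar> < e \<Longrightarrow> vector [s, t, w] \<in> W \<inter> {p. p $ 2 \<noteq> 0}"
    using open_contains_box3 p0 by blast
  \<comment> \<open>On a product box the parameters vary independently, so for fixed s the functions
    of s are constants in t and w.\<close>
  define A where "A = {p0 $ 1 - e<..<p0 $ 1 + e}"
  define S where "S = {p0 $ 2 - e<..<p0 $ 2 + e}"
  define T where "T = {p0 $ 3 - e<..<p0 $ 3 + e}"
  have op: "open A" "open S" "open T" by (auto simp: A_def S_def T_def)
  have in0: "p0 $ 1 \<in> A" "p0 $ 2 \<in> S" "p0 $ 3 \<in> T" using e by (auto simp: A_def S_def T_def)
  have AST: "vector [s, t, w] \<in> U" "n (vector [s, t, w]) \<noteq> 0" "t \<noteq> 0"
    if "s \<in> A" "t \<in> S" "w \<in> T" for s t w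
  proof -
    have "\<bar>s - p0 $ 1\<bar> < e" "\<bar>t - p0 $ 2\<bar> < e" "\<bar>w - p0 $ 3\<bar> < e"
      using that by (auto simp: A_def S_def T_def abs_less_iff)
    from box[OF this] show "vector [s, t, w] \<in> U" "n (vector [s, t, w]) \<noteq> 0" "t \<noteq> 0"
      by (auto simp: W_def)
  qed
  have AI: "s \<in> I" if "s \<in> A" for s
    using U_I[OF AST(1)[OF that in0(2,3)]] by simp
  define c where "c i s = mink C (F i s)" for i s
  have c_deriv: "(c i has_real_derivative mink C (E i s)) (at s)" if "s \<in> A" "i \<in> {1..4}" for i s
    unfolding c_def has_real_derivative_iff_has_vector_derivative
    using F_derivative[OF AI[OF that(1)] that(2)]
    by (rule bounded_linear.has_vector_derivative[OF mink.bounded_linear_right])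
  define K where "K s t w = n (vector [s, t, w]) * (f (vector [s, t, w]))\<^sup>2 * r\<^sup>2" for s t w :: real
  have f_eq: "f (vector [s, t, w]) = 1 + r * \<eta> * k 1 s * mu j lam 2 t w" for s t w
    by (simp add: f_def)
  have K: "K s t w \<noteq> 0" if "s \<in> A" "t \<in> S" "w \<in> T" for s t w
    using AST[OF that] second_mean_curvature(2) r by (simp add: K_def)
  have tang: "K s t w * mink C (DX (vector [s, t, w]) u) = 2 * Df (vector [s, t, w]) u"
    if "s \<in> A" "t \<in> S" "w \<in> T" for s t w u
    unfolding K_def using AST[OF that] eq by (intro tangential_equation)
  have phi: "phi lam w \<noteq> 0" if "s \<in> A" "t \<in> S" "w \<in> T" for s t w
    using phi_nonzero[OF AST(1)[OF that]] by simp
  have eq_t: "K s t w * (c 2 s * mu_t j lam 2 t w + c 3 s * mu_t j lam 3 t w + c 4 s * mu_t j lam 4 t w) =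
      2 * \<eta> * k 1 s * mu_t j lam 2 t w" if "s \<in> A" "t \<in> S" "w \<in> T" for s t w
  proof -
    have "r * (K s t w * (c 2 s * mu_t j lam 2 t w + c 3 s * mu_t j lam 3 t w + c 4 s * mu_t j lam 4 t w)) =
        r * (2 * \<eta> * k 1 s * mu_t j lam 2 t w)"
      using tang[OF that, of "axis 2 1"]
      by (simp add: DX_def DG_def Df_def sum_2_4 axis_def c_def mink.add_right mink.scaleR_right algebra_simps)
    then show ?thesis using r by simp
  qed
  have eq_w: "K s t w * (c 2 s * mu_w j lam 2 t w + c 3 s * mu_w j lam 3 t w + c 4 s * mu_w j lam 4 t w) =
      2 * \<eta> * k 1 s * mu_w j lam 2 t w" if "s \<in> A" "t \<in> S" "w \<in> T" for s t w
  proof -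
    have "r * (K s t w * (c 2 s * mu_w j lam 2 t w + c 3 s * mu_w j lam 3 t w + c 4 s * mu_w j lam 4 t w)) =
        r * (2 * \<eta> * k 1 s * mu_w j lam 2 t w)"
      using tang[OF that, of "axis 3 1"]
      by (simp add: DX_def DG_def Df_def sum_2_4 axis_def c_def mink.add_right mink.scaleR_right algebra_simps)
    then show ?thesis using r by simp
  qed
  have c34: "c 3 s = 0" "c 4 s = 0" if "s \<in> A" for s
  proof -
    have nz: "K s t w \<noteq> 0 \<and> phi lam w \<noteq> 0 \<and> t \<noteq> 0" if "t \<in> S" "w \<in> T" for t w
      using K phi AST(3) \<open>s \<in> A\<close> that by blast
    note * = gradient_proportional_mu2[where K = "K s" and ?c2.0 = "c 2 s" and ?c3.0 = "c 3 s" and ?c4.0 = "c 4 s"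
        and d = "2 * \<eta> * k 1 s", OF j lam op(2,3) in0(2,3) nz eq_t[OF that] eq_w[OF that]]
    show "c 3 s = 0" by (rule *(1))
    show "c 4 s = 0" by (rule *(2))
  qed
  have c2: "K s t w * c 2 s = 2 * \<eta> * k 1 s" if "s \<in> A" "t \<in> S" "w \<in> T" for s t w
    using mu2_gradient_nonzero[OF j phi[OF that] AST(3)[OF that]] eq_t[OF that] eq_w[OF that] c34[OF that(1)]
    by auto
  \<comment> \<open>\<open>c 3\<close> and \<open>c 4\<close> vanish on all of \<open>A\<close>,
    hence so do their derivatives. This leaves only \<open>E 2\<close> in the s-direction, where
    \<open>c 1 s + r * mu * \<eta> * k 1 s * c 1 s\<close> collects to
    \<open>c 1 s * f\<close>.\<close>
  have c34': "mink C (E 3 s) = 0" "mink C (E 4 s) = 0" if "s \<in> A" for s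
    using zero_on_open_imp_deriv_zero[OF op(1) that c34(1) c_deriv[OF that]]
      zero_on_open_imp_deriv_zero[OF op(1) that c34(2) c_deriv[OF that]] by simp_all
  have c1': "mink C (E 1 s) = k 1 s * c 2 s" if "s \<in> A" for s
    unfolding frenet_equations(1)[OF AI[OF that]] c_def by (simp add: mink.scaleR_right)
  have c2': "mink C (E 2 s) = \<eta> * k 1 s * c 1 s" if "s \<in> A" for s
    using c34[OF that]
    by (simp add: frenet_equations(2)[OF AI[OF that]] c_def mink.add_right mink.scaleR_right)
  have eq_s: "K s t w * c 1 s * f (vector [s, t, w]) = 2 * r * \<eta> * deriv (k 1) s * mu j lam 2 t w"
    if "s \<in> A" "t \<in> S" "w \<in> T" for s t w
    using tang[OF that, of "axis 1 1"] c34'[OF that(1)] c2'[OF that(1)]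
    by (simp add: DX_def DG_def Df_def sum_2_4 axis_def c_def f_eq mink.add_right mink.scaleR_right algebra_simps)
  have rel: "k 1 s * c 1 s = 0" "c 2 s * deriv (k 1) s = 0" if s: "s \<in> A" for s
  proof -
    \<comment> \<open>The coefficient of \<mu>_2 once \<open>K\<close> is eliminated: multiply the
      s-equation by \<open>c 2 s\<close> and replace \<open>K s t w * c 2 s\<close>. It is constant
      in t and w, and the gradient of \<mu>_2 is non-zero, so differentiation gives
      \<open>D = 0\<close>.\<close>
    define D where "D = r * \<eta> * (k 1 s)\<^sup>2 * c 1 s - r * c 2 s * deriv (k 1) s"
    have affine: "k 1 s * c 1 s + D * mu j lam 2 t w = 0" if "t \<in> S" "w \<in> T" for t w
    proof -
      have "(2 * \<eta> * k 1 s) * c 1 s * f (vector [s, t, w]) = c 2 s * (2 * r * \<eta> * deriv (k 1) s * mu j lam 2 t w)"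
        unfolding c2[OF s that, symmetric] eq_s[OF s that, symmetric] by simp
      then have "2 * \<eta> * (k 1 s * c 1 s + D * mu j lam 2 t w) = 0"
        unfolding f_eq D_def by (simp add: algebra_simps power2_eq_square)
      moreover have "\<eta> \<noteq> 0" using eta_square by auto
      ultimately show ?thesis by simp
    qed
    have "D * mu_t j lam 2 (p0 $ 2) (p0 $ 3) = 0"
      by (rule zero_on_open_imp_deriv_zero[OF op(2) in0(2) affine[OF _ in0(3)]])
        (auto intro!: derivative_eq_intros mu_has_partial_derivatives lam)
    moreover have "D * mu_w j lam 2 (p0 $ 2) (p0 $ 3) = 0"
      by (rule zero_on_open_imp_deriv_zero[OF op(3) in0(3) affine[OF in0(2)]])
        (auto intro!: derivative_eq_intros mu_has_partial_derivatives lam)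
    ultimately have "D = 0"
      using mu2_gradient_nonzero[OF j phi[OF in0] AST(3)[OF in0]] by auto
    then show "k 1 s * c 1 s = 0"
      using affine[OF in0(2,3)] by simp
    then have "r * \<eta> * (k 1 s)\<^sup>2 * c 1 s = 0"
      by auto
    then show "c 2 s * deriv (k 1) s = 0"
      using \<open>D = 0\<close> r by (auto simp: D_def)
  qed
  have c1_zero: "c 1 s = 0" if "s \<in> A" "deriv (k 1) s = 0" for s
    using eq_s[OF that(1) in0(2,3)] that K[OF that(1) in0(2,3)]
      second_mean_curvature(2)[OF AST(1)[OF that(1) in0(2,3)]] by simp
  \<comment> \<open>Where \<open>c 2\<close> is non-zero, an open set, the derivative of
    \<open>k 1\<close> vanishes, hence \<open>c 1\<close> does too. Then 0 = c_1' = k_1 c_2 forces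
    \<open>k 1 s = 0\<close>, and \<open>K s t w * c 2 s = 0\<close> is absurd.\<close>
  have c2_zero: "c 2 s = 0" if s: "s \<in> A" for s
  proof (rule ccontr)
    assume nz: "c 2 s \<noteq> 0"
    define B where "B = {x \<in> A. c 2 x \<noteq> 0}"
    have "continuous_on A (c 2)"
      using c_deriv[of _ 2] by (intro continuous_at_imp_continuous_on ballI DERIV_isCont) auto
    then have "open B"
      using continuous_open_preimage[OF _ op(1), of "c 2" "- {0}"]
      by (simp add: B_def vimage_def Int_def open_Compl)
    moreover have "s \<in> B" using s nz by (simp add: B_def)
    moreover have "c 1 x = 0" if "x \<in> B" for x
      using that rel(2) by (intro c1_zero) (auto simp: B_def)
    ultimately have "mink C (E 1 s) = 0"
      using zero_on_open_imp_deriv_zero[OF _ _ _ c_deriv[OF s, of 1]] by auto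
    then have "k 1 s = 0" using c1'[OF s] nz by simp
    then show False
      using c2[OF s in0(2,3)] K[OF s in0(2,3)] nz by simp
  qed
  \<comment> \<open>With \<open>c 2 s = 0\<close>, the equation \<open>c2\<close> reads 0 = 2 \<eta>
    k_1. Thus \<open>k 1\<close> and its derivative vanish, which yields
    \<open>c 1 (p0 $ 1) = 0\<close>.\<close>
  have k1_zero: "k 1 s = 0" if "s \<in> A" for s
    using c2[OF that in0(2,3)] c2_zero[OF that] eta_square by auto
  have "deriv (k 1) (p0 $ 1) = 0"
    by (rule zero_on_open_imp_deriv_zero[OF op(1) in0(1) k1_zero k1_derivative[OF AI[OF in0(1)]]])
  then have "c 1 (p0 $ 1) = 0"
    by (rule c1_zero[OF in0(1)])
  then have "mink C (F i (p0 $ 1)) = 0" if "i \<in> {1..4}" for i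
  proof -
    have "i = 1 \<or> i = 2 \<or> i = 3 \<or> i = 4" using that by auto
    then show ?thesis
      using \<open>c 1 (p0 $ 1) = 0\<close> c2_zero[OF in0(1)] c34[OF in0(1)] by (auto simp: c_def)
  qed
  then have "C = 0"
    by (intro mink_frame_nondegenerate[of "\<lambda>i. F i (p0 $ 1)"]) (auto simp: frame[OF AI[OF in0(1)]])
  with C show False by simp
qed

end

theorem theorem9:
  fixes j :: nat and lam :: int and r :: real
    and I :: "real set" and \<beta> :: "real \<Rightarrow> real ^ 4"
    and F :: "nat \<Rightarrow> real \<Rightarrow> real ^ 4" and k :: "nat \<Rightarrow> real \<Rightarrow> real"
    and U :: "(real ^ 3) set"
  assumes "j \<in> {2, 3, 4}" and "lam \<in> {1, -1}" and "r > 0"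
    and "open I" and "is_interval I" and "I \<noteq> {}"
    and "frenet_curve I j \<beta> F k"
    and "open U" and "connected U" and "(\<lambda>p. p $ 1) ` U = I"
    and "immersion_on U (tube j lam r \<beta> F)"
  shows "\<not> generalized_L1_1type_gauss U (tube j lam r \<beta> F) (tube_normal j lam F)"
proof -
  interpret frenet_tube j lam r I \<beta> F k U
    using assms by unfold_locales auto
  show ?thesis by (rule not_generalized_L1_1type_gauss)
qed

end
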